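(* Let $A$ be a commutative ring with identity. Then $\operatorname{Sq} A$ is a normal space if and only if $\operatorname{Spec} A$ (with the Zariski topology) is a normal space.
   Context: A proper ideal $\mathfrak{q}$ of $A$ is called quasi-prime if whenever $fg\in\mathfrak{q}$ with $f,g\in A$, then $f\in\sqrt{\mathfrak{q}}$ or $g\in\sqrt{\mathfrak{q}}$. The quasi-prime spectrum $\operatorname{Sq} A$ is the set of all quasi-prime ideals of $A$, with the topology having as basis of opens the sets $U_f=\{\mathfrak{q}\in\operatorname{Sq} A: \mathfrak{q}\cap S_f=\emptyset\}$ for $f\in A$, where $S_f=\{f^i : i\ge 0\}=\{1,f,f^2,\dots\}$. A topological space is called normal if every two disjoint closed subsets admit disjoint open neighborhoods (no separation axiom such as $T_1$ is assumed). *)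

theory Defs
  imports "HOL-Analysis.Abstract_Topological_Spaces" "HOL-Algebra.Ideal"
begin

definition radical_of :: "('a, 'b) ring_scheme \<Rightarrow> 'a set \<Rightarrow> 'a set"
  where "radical_of R I = {a \<in> carrier R. \<exists>n::nat. 0 < n \<and> a [^]\<^bsub>R\<^esub> n \<in> I}"

definition quasi_prime :: "'a set \<Rightarrow> ('a, 'b) ring_scheme \<Rightarrow> bool"
  where "quasi_prime q R \<longleftrightarrow> ideal q R \<and> q \<noteq> carrier R \<and>
    (\<forall>f \<in> carrier R. \<forall>g \<in> carrier R. f \<otimes>\<^bsub>R\<^esub> g \<in> q \<longrightarrow>
       f \<in> radical_of R q \<or> g \<in> radical_of R q)"

definition Sq :: "('a, 'b) ring_scheme \<Rightarrow> 'a set set"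
  where "Sq R = {q. quasi_prime q R}"

definition powers_of :: "('a, 'b) ring_scheme \<Rightarrow> 'a \<Rightarrow> 'a set"
  where "powers_of R f = range (\<lambda>i::nat. f [^]\<^bsub>R\<^esub> i)"

definition Sq_basic_open :: "('a, 'b) ring_scheme \<Rightarrow> 'a \<Rightarrow> 'a set set"
  where "Sq_basic_open R f = {q \<in> Sq R. q \<inter> powers_of R f = {}}"

definition Sq_topology :: "('a, 'b) ring_scheme \<Rightarrow> 'a set topology"
  where "Sq_topology R =
    topology (arbitrary union_of (\<lambda>U. U \<in> Sq_basic_open R ` carrier R))"

definition Spec :: "('a, 'b) ring_scheme \<Rightarrow> 'a set set"
  where "Spec R = {p. primeideal p R}"

definition zariski_locus :: "('a, 'b) ring_scheme \<Rightarrow> 'a set \<Rightarrow> 'a set set"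
  where "zariski_locus R E = {p \<in> Spec R. E \<subseteq> p}"

definition zariski_topology :: "('a, 'b) ring_scheme \<Rightarrow> 'a set topology"
  where "zariski_topology R =
    topology (\<lambda>U. \<exists>E \<subseteq> carrier R. U = Spec R - zariski_locus R E)"

text \<open>
  The constant \<^const>\<open>topology\<close> is only meaningful on predicates satisfying \<^const>\<open>istopology\<close>,
  so the lemmas below establish that property for the two definitions above.
\<close>

lemma Sq_not_mem_radical_iff:
  assumes "q \<in> Sq R" "cring R" "f \<in> carrier R"
  shows "q \<inter> powers_of R f = {} \<longleftrightarrow> f \<notin> radical_of R q"
proof -
  interpret cring R by fact
  have q: "ideal q R" "q \<noteq> carrier R"
    using assms by (auto simp: Sq_def quasi_prime_def)
  have "\<one>\<^bsub>R\<^esub> \<notin> q"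
    using q ideal.one_imp_carrier by blast
  then have "(\<exists>n::nat. f [^]\<^bsub>R\<^esub> n \<in> q) \<longleftrightarrow> (\<exists>n::nat. 0 < n \<and> f [^]\<^bsub>R\<^esub> n \<in> q)"
    by (metis gr0I nat_pow_0)
  moreover have "q \<inter> powers_of R f = {} \<longleftrightarrow> \<not> (\<exists>n::nat. f [^]\<^bsub>R\<^esub> n \<in> q)"
    unfolding powers_of_def by blast
  ultimately show ?thesis
    using assms(3) unfolding radical_of_def by blast
qed

lemma Sq_basic_open_mult:
  assumes "cring R" and f: "f \<in> carrier R" and g: "g \<in> carrier R"
  shows "Sq_basic_open R f \<inter> Sq_basic_open R g = Sq_basic_open R (f \<otimes>\<^bsub>R\<^esub> g)"
proof -
  interpret cring R by fact
  have fg: "f \<otimes>\<^bsub>R\<^esub> g \<in> carrier R"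
    using f g by simp
  have "f \<otimes>\<^bsub>R\<^esub> g \<in> radical_of R q \<longleftrightarrow> f \<in> radical_of R q \<or> g \<in> radical_of R q"
    if q: "q \<in> Sq R" for q
  proof -
    interpret ideal q R
      using q by (auto simp: Sq_def quasi_prime_def)
    have prime: "a \<in> radical_of R q \<or> b \<in> radical_of R q"
      if "a \<in> carrier R" "b \<in> carrier R" "a \<otimes>\<^bsub>R\<^esub> b \<in> q" for a b
      using q that by (auto simp: Sq_def quasi_prime_def)
    have root: "a \<in> radical_of R q"
      if a: "a \<in> carrier R" and n: "0 < n" and mem: "a [^]\<^bsub>R\<^esub> n \<in> radical_of R q" for a and n :: nat
    proof -
      obtain m :: nat where "0 < m" "(a [^]\<^bsub>R\<^esub> n) [^]\<^bsub>R\<^esub> m \<in> q"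
        using mem by (auto simp: radical_of_def)
      then have "0 < n * m" "a [^]\<^bsub>R\<^esub> (n * m) \<in> q"
        using a n by (auto simp: nat_pow_pow)
      then show ?thesis
        using a unfolding radical_of_def by blast
    qed
    show ?thesis
    proof
      assume "f \<otimes>\<^bsub>R\<^esub> g \<in> radical_of R q"
      then obtain n :: nat where n: "0 < n" "(f \<otimes>\<^bsub>R\<^esub> g) [^]\<^bsub>R\<^esub> n \<in> q"
        by (auto simp: radical_of_def)
      then have "f [^]\<^bsub>R\<^esub> n \<otimes>\<^bsub>R\<^esub> g [^]\<^bsub>R\<^esub> n \<in> q"
        using f g by (simp add: nat_pow_distrib)
      then show "f \<in> radical_of R q \<or> g \<in> radical_of R q"
        using prime[of "f [^]\<^bsub>R\<^esub> n" "g [^]\<^bsub>R\<^esub> n"] root[OF f n(1)] root[OF g n(1)] f g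
        by blast
    next
      assume "f \<in> radical_of R q \<or> g \<in> radical_of R q"
      then obtain n :: nat where n: "0 < n" "f [^]\<^bsub>R\<^esub> n \<in> q \<or> g [^]\<^bsub>R\<^esub> n \<in> q"
        by (auto simp: radical_of_def)
      then have "f [^]\<^bsub>R\<^esub> n \<otimes>\<^bsub>R\<^esub> g [^]\<^bsub>R\<^esub> n \<in> q"
        using I_l_closed[of "g [^]\<^bsub>R\<^esub> n" "f [^]\<^bsub>R\<^esub> n"] I_r_closed[of "f [^]\<^bsub>R\<^esub> n" "g [^]\<^bsub>R\<^esub> n"] f g
        by blast
      then show "f \<otimes>\<^bsub>R\<^esub> g \<in> radical_of R q"
        using n(1) fg f g by (force simp: radical_of_def nat_pow_distrib)
    qed
  qed
  moreover have "Sq_basic_open R h = {q \<in> Sq R. h \<notin> radical_of R q}" if "h \<in> carrier R" for h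
    unfolding Sq_basic_open_def
    by (intro Collect_cong conj_cong refl Sq_not_mem_radical_iff assms(1) that)
  ultimately show ?thesis
    using f g fg by auto
qed

lemma openin_Sq_topology:
  assumes "cring R"
  shows "openin (Sq_topology R) = arbitrary union_of (\<lambda>U. U \<in> Sq_basic_open R ` carrier R)"
proof -
  interpret cring R by fact
  have "istopology (arbitrary union_of (\<lambda>U. U \<in> Sq_basic_open R ` carrier R))"
    using assms by (intro istopology_base) (auto simp: Sq_basic_open_mult)
  then show ?thesis
    by (simp add: Sq_topology_def)
qed

lemma topspace_Sq_topology:
  assumes "cring R"
  shows "topspace (Sq_topology R) = Sq R"
proof
  interpret cring R by fact
  show "topspace (Sq_topology R) \<subseteq> Sq R"
    unfolding topspace_def openin_Sq_topology[OF assms]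
    by (auto simp: union_of_def Sq_basic_open_def)
  have "Sq_basic_open R \<one>\<^bsub>R\<^esub> = Sq R"
    using ideal.one_imp_carrier
    by (fastforce simp: Sq_basic_open_def powers_of_def Sq_def quasi_prime_def)
  moreover have "openin (Sq_topology R) (Sq_basic_open R \<one>\<^bsub>R\<^esub>)"
    unfolding openin_Sq_topology[OF assms] by (intro arbitrary_union_of_inc) auto
  ultimately show "Sq R \<subseteq> topspace (Sq_topology R)"
    using openin_subset by fastforce
qed

lemma openin_zariski_topology:
  assumes "cring R"
  shows "openin (zariski_topology R) U \<longleftrightarrow> (\<exists>E \<subseteq> carrier R. U = Spec R - zariski_locus R E)"
proof -
  interpret cring R by fact
  define P where "P U \<longleftrightarrow> (\<exists>E \<subseteq> carrier R. U = Spec R - zariski_locus R E)" for U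
  have "P (S \<inter> T)" if "P S" "P T" for S T
  proof -
    obtain E F where E: "E \<subseteq> carrier R" "S = Spec R - zariski_locus R E"
      and F: "F \<subseteq> carrier R" "T = Spec R - zariski_locus R F"
      using \<open>P S\<close> \<open>P T\<close> by (auto simp: P_def)
    define G where "G = {x \<otimes>\<^bsub>R\<^esub> y | x y. x \<in> E \<and> y \<in> F}"
    have G: "G \<subseteq> carrier R"
      using E F by (auto simp: G_def)
    have "G \<subseteq> p \<longleftrightarrow> E \<subseteq> p \<or> F \<subseteq> p" if "p \<in> Spec R" for p
    proof -
      interpret primeideal p R
        using that by (simp add: Spec_def)
      show ?thesis
      proof
        assume Gp: "G \<subseteq> p"
        show "E \<subseteq> p \<or> F \<subseteq> p"
        proof (rule ccontr)
          assume "\<not> (E \<subseteq> p \<or> F \<subseteq> p)"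
          then obtain x y where "x \<in> E" "x \<notin> p" "y \<in> F" "y \<notin> p"
            by blast
          moreover from this have "x \<otimes>\<^bsub>R\<^esub> y \<in> p"
            using Gp by (auto simp: G_def)
          ultimately show False
            using I_prime E F by blast
        qed
      next
        assume "E \<subseteq> p \<or> F \<subseteq> p"
        then have "x \<otimes>\<^bsub>R\<^esub> y \<in> p" if "x \<in> E" "y \<in> F" for x y
          using that E(1) F(1) I_l_closed[of y x] I_r_closed[of x y] by blast
        then show "G \<subseteq> p"
          by (auto simp: G_def)
      qed
    qed
    then have "S \<inter> T = Spec R - zariski_locus R G"
      using E F by (auto simp: zariski_locus_def)
    then show ?thesis
      using G by (auto simp: P_def)
  qed
  moreover have "P (\<Union>\<K>)" if "\<forall>K \<in> \<K>. P K" for \<K>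
  proof -
    have "\<forall>K \<in> \<K>. \<exists>E. E \<subseteq> carrier R \<and> K = Spec R - zariski_locus R E"
      using that unfolding P_def by blast
    from bchoice[OF this] obtain E
      where E: "\<And>K. K \<in> \<K> \<Longrightarrow> E K \<subseteq> carrier R \<and> K = Spec R - zariski_locus R (E K)"
      by blast
    have "\<Union>\<K> = (\<Union>K \<in> \<K>. Spec R - zariski_locus R (E K))"
      using E by auto
    also have "\<dots> = Spec R - zariski_locus R (\<Union>K \<in> \<K>. E K)"
      by (auto simp: zariski_locus_def)
    finally show ?thesis
      using E unfolding P_def by (intro exI[of _ "\<Union>K \<in> \<K>. E K"]) auto
  qed
  ultimately have "istopology P"
    by (simp add: istopology_def)
  then show ?thesis
    by (simp add: zariski_topology_def P_def[abs_def])
qed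

lemma topspace_zariski_topology:
  assumes "cring R"
  shows "topspace (zariski_topology R) = Spec R"
proof
  interpret cring R by fact
  show "topspace (zariski_topology R) \<subseteq> Spec R"
    by (auto simp: topspace_def openin_zariski_topology[OF assms])
  have "zariski_locus R {\<one>\<^bsub>R\<^esub>} = {}"
    using ideal.one_imp_carrier primeideal.I_notcarr primeideal.axioms(1)
    by (fastforce simp: zariski_locus_def Spec_def)
  then have "openin (zariski_topology R) (Spec R)"
    unfolding openin_zariski_topology[OF assms] by (intro exI[of _ "{\<one>\<^bsub>R\<^esub>}"]) auto
  then show "Spec R \<subseteq> topspace (zariski_topology R)"
    by (rule openin_subset)
qed

end

theory Submission
  imports Defs
begin

text \<open>
  Taking radicals maps \<^term>\<open>Sq A\<close> onto \<^term>\<open>Spec A\<close>: the radical of a quasi-prime ideal is prime,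
  and a prime ideal is quasi-prime and equal to its own radical. A quasi-prime ideal avoids every
  power of \<open>f\<close> exactly when its radical avoids \<open>f\<close>, so the basic open set of \<^term>\<open>Sq A\<close> given by
  \<open>f\<close> is the preimage of the basic open set of \<^term>\<open>Spec A\<close> given by \<open>f\<close>. The topology of
  \<^term>\<open>Sq A\<close> is therefore the initial topology of a surjection onto \<^term>\<open>Spec A\<close>
  (\<open>Sq_topology_eq_pullback\<close>).

  For such a surjection, taking preimages is a bijection from the open sets of the target to those
  of the source that commutes with complements and preserves and reflects inclusion and
  disjointness. Normality speaks only of these relations between open and closed sets, with no
  reference to points, so it holds on one side exactly when it holds on the other
  (\<open>normal_space_pullback_topology\<close>).
\<close>

section \<open>Normality of initial topologies\<close>

lemma closedin_pullback_topology:
  assumes "f ` A \<subseteq> topspace T"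
  shows "closedin (pullback_topology A f T) S \<longleftrightarrow> (\<exists>C. closedin T C \<and> S = f -` C \<inter> A)"
proof
  have top: "topspace (pullback_topology A f T) = A"
    using assms by (auto simp: topspace_pullback_topology)
  {
    assume "closedin (pullback_topology A f T) S"
    then obtain U where "S \<subseteq> A" "openin T U" "A - S = f -` U \<inter> A"
      by (auto simp: closedin_def top openin_pullback_topology)
    moreover from this have "S = f -` (topspace T - U) \<inter> A"
      using assms by blast
    moreover have "closedin T (topspace T - U)"
      using \<open>openin T U\<close> by blast
    ultimately show "\<exists>C. closedin T C \<and> S = f -` C \<inter> A"
      by blast
  next
    assume "\<exists>C. closedin T C \<and> S = f -` C \<inter> A"
    then obtain C where C: "closedin T C" "S = f -` C \<inter> A"
      by blast
    then have "A - S = f -` (topspace T - C) \<inter> A"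
      using assms by auto
    with C show "closedin (pullback_topology A f T) S"
      by (auto simp: closedin_def top openin_pullback_topology)
  }
qed

text \<open>
  Surjectivity makes the preimage map injective on subsets of the target and lets it reflect
  inclusion and disjointness. For an inclusion map the source would be a mere subspace, and
  normality neither descends to subspaces nor ascends from them.
\<close>

lemma normal_space_pullback_topology:
  assumes surj: "f ` A = topspace T"
  shows "normal_space (pullback_topology A f T) \<longleftrightarrow> normal_space T"
proof -
  have closed: "closedin (pullback_topology A f T) S \<longleftrightarrow> (\<exists>C. closedin T C \<and> S = f -` C \<inter> A)" for S
    using surj by (intro closedin_pullback_topology) simp
  have sub: "f -` S \<inter> A \<subseteq> f -` U \<inter> A \<longleftrightarrow> S \<subseteq> U" if "S \<subseteq> topspace T" for S U
    using that unfolding surj[symmetric] by blast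
  have disj: "disjnt (f -` S \<inter> A) (f -` U \<inter> A) \<longleftrightarrow> disjnt S U" if "S \<subseteq> topspace T" for S U
    using that unfolding surj[symmetric] disjnt_def by blast
  show ?thesis
  proof
    assume L: "normal_space (pullback_topology A f T)"
    show "normal_space T"
      unfolding normal_space_def
    proof (intro allI impI, elim conjE)
      fix S S' assume S: "closedin T S" "closedin T S'" "disjnt S S'"
      have "disjnt (f -` S \<inter> A) (f -` S' \<inter> A)"
        using S disj[OF closedin_subset] by metis
      moreover have "closedin (pullback_topology A f T) (f -` S \<inter> A)"
        "closedin (pullback_topology A f T) (f -` S' \<inter> A)"
        using S closed by blast+
      ultimately obtain U' V' where
        "openin (pullback_topology A f T) U'" "openin (pullback_topology A f T) V'"
        "f -` S \<inter> A \<subseteq> U'" "f -` S' \<inter> A \<subseteq> V'" "disjnt U' V'"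
        using L unfolding normal_space_def by meson
      then obtain U V where UV: "openin T U" "openin T V"
        "f -` S \<inter> A \<subseteq> f -` U \<inter> A" "f -` S' \<inter> A \<subseteq> f -` V \<inter> A"
        "disjnt (f -` U \<inter> A) (f -` V \<inter> A)"
        unfolding openin_pullback_topology by blast
      have "S \<subseteq> U" "S' \<subseteq> V"
        using sub[OF closedin_subset] S UV by metis+
      moreover have "disjnt U V"
        using disj[OF openin_subset] UV by metis
      ultimately show "\<exists>U V. openin T U \<and> openin T V \<and> S \<subseteq> U \<and> S' \<subseteq> V \<and> disjnt U V"
        using UV by blast
    qed
  next
    assume R: "normal_space T"
    show "normal_space (pullback_topology A f T)"
      unfolding normal_space_def
    proof (intro allI impI, elim conjE)
      fix S S' assume "closedin (pullback_topology A f T) S"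
        "closedin (pullback_topology A f T) S'" and dj: "disjnt S S'"
      then obtain C C' where C: "closedin T C" "S = f -` C \<inter> A" "closedin T C'" "S' = f -` C' \<inter> A"
        unfolding closed by blast
      then have "disjnt C C'"
        using dj disj[OF closedin_subset] by metis
      then obtain U V where UV: "openin T U" "openin T V" "C \<subseteq> U" "C' \<subseteq> V" "disjnt U V"
        using R C unfolding normal_space_def by meson
      have "openin (pullback_topology A f T) (f -` U \<inter> A)"
        "openin (pullback_topology A f T) (f -` V \<inter> A)"
        using UV openin_pullback_topology by blast+
      moreover have "S \<subseteq> f -` U \<inter> A" "S' \<subseteq> f -` V \<inter> A"
        using UV C by blast+
      moreover have "disjnt (f -` U \<inter> A) (f -` V \<inter> A)"
        using disj[OF openin_subset] UV by metis
      ultimately show "\<exists>U V. openin (pullback_topology A f T) U \<and>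
          openin (pullback_topology A f T) V \<and> S \<subseteq> U \<and> S' \<subseteq> V \<and> disjnt U V"
        by blast
    qed
  qed
qed

section \<open>Radicals of ideals\<close>

lemma nat_pow_mem_ideal_mono:
  fixes R (structure) and m n :: nat
  assumes "ideal I R" "a \<in> carrier R" "a [^] m \<in> I" "m \<le> n"
  shows "a [^] n \<in> I"
proof -
  interpret ideal I R by fact
  have "a [^] n = a [^] (n - m) \<otimes> a [^] m"
    using assms by (simp add: nat_pow_mult)
  then show ?thesis
    using assms I_l_closed by simp
qed

text \<open>
  The two exponents \<open>i\<close> and \<open>j\<close> make an induction on \<open>k\<close> do the work of the binomial theorem: peeling off one factor \<open>a + b\<close> at a time moves
  it into one of the first two powers, and in total degree at least \<open>m + n\<close> one of those two must
  end up with a large enough exponent.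
\<close>

lemma mult_pow_add_mem_ideal:
  fixes R (structure) and i j k m n :: nat
  assumes "ideal I R" "cring R" and ab: "a \<in> carrier R" "b \<in> carrier R"
    and m: "a [^] m \<in> I" and n: "b [^] n \<in> I"
    and "m + n \<le> i + j + k"
  shows "a [^] i \<otimes> b [^] j \<otimes> (a \<oplus> b) [^] k \<in> I"
  using assms(7)
proof (induction k arbitrary: i j)
  interpret ideal I R by fact
  interpret cring R by fact
  {
    case 0
    then have "m \<le> i \<or> n \<le> j"
      by linarith
    then have "a [^] i \<in> I \<or> b [^] j \<in> I"
      using nat_pow_mem_ideal_mono[OF assms(1)] ab m n by blast
    then show ?case
      using ab I_l_closed I_r_closed by auto
  next
    case (Suc k)
    have "a [^] Suc i \<otimes> b [^] j \<otimes> (a \<oplus> b) [^] k \<in> I" "a [^] i \<otimes> b [^] Suc j \<otimes> (a \<oplus> b) [^] k \<in> I"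
      using Suc.prems by (intro Suc.IH; simp)+
    moreover have "a [^] i \<otimes> b [^] j \<otimes> (a \<oplus> b) [^] Suc k =
        a [^] Suc i \<otimes> b [^] j \<otimes> (a \<oplus> b) [^] k \<oplus> a [^] i \<otimes> b [^] Suc j \<otimes> (a \<oplus> b) [^] k"
    proof -
      define x y z where "x = a [^] i" and "y = b [^] j" and "z = (a \<oplus> b) [^] k"
      have "x \<in> carrier R" "y \<in> carrier R" "z \<in> carrier R"
        using ab by (simp_all add: x_def y_def z_def)
      then have "x \<otimes> y \<otimes> (z \<otimes> (a \<oplus> b)) = x \<otimes> a \<otimes> y \<otimes> z \<oplus> x \<otimes> (y \<otimes> b) \<otimes> z"
        using ab by (simp add: r_distr m_ac)
      then show ?thesis
        by (simp add: x_def y_def z_def)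
    qed
    ultimately show ?case
      by simp
  }
qed

lemma ideal_radical_of:
  fixes R (structure)
  assumes "ideal I R" "cring R"
  shows "ideal (radical_of R I) R"
proof -
  interpret ideal I R by fact
  interpret cring R by fact
  have mult: "x \<otimes> a \<in> radical_of R I" if "a \<in> radical_of R I" "x \<in> carrier R" for a x
  proof -
    obtain n :: nat where n: "a \<in> carrier R" "0 < n" "a [^] n \<in> I"
      using \<open>a \<in> radical_of R I\<close> by (auto simp: radical_of_def)
    then have "(x \<otimes> a) [^] n \<in> I"
      using that I_l_closed by (simp add: nat_pow_distrib)
    then show ?thesis
      using n that by (auto simp: radical_of_def)
  qed
  have add: "a \<oplus> b \<in> radical_of R I" if ab: "a \<in> radical_of R I" "b \<in> radical_of R I" for a b
  proof -
    obtain m n :: nat where mn: "a \<in> carrier R" "a [^] m \<in> I" "b \<in> carrier R" "0 < n" "b [^] n \<in> I"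
      using ab by (auto simp: radical_of_def)
    then have "(a \<oplus> b) [^] (m + n) \<in> I"
      using mult_pow_add_mem_ideal[OF assms, of a b m n 0 0 "m + n"] by simp
    moreover have "0 < m + n"
      using mn by simp
    ultimately show ?thesis
      using mn unfolding radical_of_def by blast
  qed
  show ?thesis
  proof (rule idealI)
    show "subgroup (radical_of R I) (add_monoid R)"
    proof (rule add.subgroupI)
      show "radical_of R I \<subseteq> carrier R"
        by (auto simp: radical_of_def)
      have "\<zero> [^] (1::nat) \<in> I"
        by (simp add: zero_closed additive_subgroup.zero_closed is_additive_subgroup)
      then show "radical_of R I \<noteq> {}"
        unfolding radical_of_def using zero_less_one by blast
    next
      fix a assume a: "a \<in> radical_of R I"
      then have "a \<in> carrier R"
        by (simp add: radical_of_def)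
      then have "\<ominus> a = \<ominus> \<one> \<otimes> a"
        by (simp add: l_minus)
      then show "\<ominus> a \<in> radical_of R I"
        using mult[OF a, of "\<ominus> \<one>"] by simp
    qed (use add in auto)
    show "a \<otimes> x \<in> radical_of R I" if "a \<in> radical_of R I" "x \<in> carrier R" for a x
      using mult[OF that] that by (simp add: radical_of_def m_comm)
  qed (use mult ring_axioms in auto)
qed

lemma (in primeideal) nat_pow_memD:
  assumes "a \<in> carrier R" "a [^] (n::nat) \<in> I"
  shows "a \<in> I"
  using assms(2)
proof (induction n)
  case 0
  then show ?case
    using one_imp_carrier I_notcarr by simp
next
  case (Suc n)
  then show ?case
    using I_prime[of "a [^] n" a] assms(1) by auto
qed

lemma radical_of_primeideal:
  assumes "primeideal p R"
  shows "radical_of R p = p"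
proof -
  interpret primeideal p R by fact
  have "p \<subseteq> radical_of R p"
  proof
    fix a assume "a \<in> p"
    then have "a \<in> carrier R" "a [^]\<^bsub>R\<^esub> (1::nat) \<in> p"
      using Icarr by simp_all
    then show "a \<in> radical_of R p"
      unfolding radical_of_def using zero_less_one by blast
  qed
  moreover have "radical_of R p \<subseteq> p"
    using nat_pow_memD by (auto simp: radical_of_def)
  ultimately show ?thesis
    by blast
qed

section \<open>The radical map from the quasi-prime spectrum to the prime spectrum\<close>

lemma Sq_basic_open_eq:
  assumes "cring R" "f \<in> carrier R"
  shows "Sq_basic_open R f = {q \<in> Sq R. f \<notin> radical_of R q}"
  unfolding Sq_basic_open_def using Sq_not_mem_radical_iff[OF _ assms] by blast

lemma Spec_subset_Sq: "Spec R \<subseteq> Sq R"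
proof
  fix p assume "p \<in> Spec R"
  then have p: "primeideal p R"
    by (simp add: Spec_def)
  interpret primeideal p R by fact
  show "p \<in> Sq R"
    unfolding Sq_def quasi_prime_def mem_Collect_eq radical_of_primeideal[OF p]
    using is_ideal I_notcarr I_prime by blast
qed

text \<open>
  That a product lies in the radical only if a factor does is the inclusion of
  \<open>U\<^sub>f \<inter> U\<^sub>g\<close> in \<open>U\<^sub>f\<^sub>g\<close>, read through the description of the basic open sets by radicals.
\<close>

lemma radical_of_mem_Spec:
  assumes "cring R" and q: "q \<in> Sq R"
  shows "radical_of R q \<in> Spec R"
proof -
  interpret cring R by fact
  interpret ideal q R
    using q by (simp add: Sq_def quasi_prime_def)
  have "\<one>\<^bsub>R\<^esub> \<notin> q"
    using q one_imp_carrier by (auto simp: Sq_def quasi_prime_def)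
  then have "\<one>\<^bsub>R\<^esub> \<notin> radical_of R q"
    by (simp add: radical_of_def)
  then have "carrier R \<noteq> radical_of R q"
    by auto
  moreover have "a \<in> radical_of R q \<or> b \<in> radical_of R q"
    if "a \<in> carrier R" "b \<in> carrier R" "a \<otimes>\<^bsub>R\<^esub> b \<in> radical_of R q" for a b
    using that q Sq_basic_open_mult[OF assms(1), of a b] by (auto simp: Sq_basic_open_eq[OF assms(1)])
  ultimately have "primeideal (radical_of R q) R"
    using ideal_radical_of[OF is_ideal assms(1)] assms(1) by (intro primeidealI) auto
  then show ?thesis
    by (simp add: Spec_def)
qed

lemma radical_of_image_Sq:
  assumes "cring R"
  shows "radical_of R ` Sq R = Spec R"
proof
  show "radical_of R ` Sq R \<subseteq> Spec R"
    using radical_of_mem_Spec[OF assms] by blast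
  show "Spec R \<subseteq> radical_of R ` Sq R"
  proof
    fix p assume p: "p \<in> Spec R"
    then have "p = radical_of R p"
      by (simp add: Spec_def radical_of_primeideal)
    then show "p \<in> radical_of R ` Sq R"
      using p Spec_subset_Sq by blast
  qed
qed

text \<open>
  Both topologies have one open set for each subset \<open>E\<close> of the ring: a union of basic open sets on
  one side, the complement of the zero locus of \<open>E\<close> on the other. The radical map matches the two
  open sets with the same \<open>E\<close>.
\<close>

lemma Sq_topology_eq_pullback:
  assumes "cring R"
  shows "Sq_topology R = pullback_topology (Sq R) (radical_of R) (zariski_topology R)"
proof (rule topology_eq[THEN iffD2], rule allI)
  fix U
  have preimage: "radical_of R -` (Spec R - zariski_locus R E) \<inter> Sq R = (\<Union>f\<in>E. Sq_basic_open R f)"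
    if "E \<subseteq> carrier R" for E
    using that radical_of_mem_Spec[OF assms]
    by (auto simp: zariski_locus_def Sq_basic_open_eq[OF assms] subset_iff)
  have "openin (Sq_topology R) U \<longleftrightarrow> (\<exists>E \<subseteq> carrier R. U = (\<Union>f\<in>E. Sq_basic_open R f))"
    unfolding openin_Sq_topology[OF assms] union_of_def arbitrary_def
    by (auto simp: subset_image_iff)
  also have "\<dots> \<longleftrightarrow> (\<exists>E \<subseteq> carrier R. U = radical_of R -` (Spec R - zariski_locus R E) \<inter> Sq R)"
    by (metis preimage)
  also have "\<dots> \<longleftrightarrow> openin (pullback_topology (Sq R) (radical_of R) (zariski_topology R)) U"
    unfolding openin_pullback_topology openin_zariski_topology[OF assms] by blast
  finally show "openin (Sq_topology R) U \<longleftrightarrow>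
      openin (pullback_topology (Sq R) (radical_of R) (zariski_topology R)) U" .
qed

theorem proposition5p1:
  fixes A :: "('a, 'b) ring_scheme"
  assumes "cring A"
  shows "normal_space (Sq_topology A) \<longleftrightarrow> normal_space (zariski_topology A)"
  unfolding Sq_topology_eq_pullback[OF assms]
  using radical_of_image_Sq[OF assms]
  by (intro normal_space_pullback_topology) (simp add: topspace_zariski_topology[OF assms])

end
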